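(* For a labeled Petri net, let $\sim$, $\approx$ and $\simeq$ denote bisimilarity, resource similarity and resource bisimilarity, respectively (relations on the set $\mathcal{M}(P)$ of multisets over its place set $P$, as defined in the context). Then: (1) For each labeled Petri net we have $\simeq\,\subseteq\,\approx\,\subseteq\,\sim$; moreover, $\approx$ is the largest congruence included in $\sim$, and $\simeq$ is the largest congruence included in $\sim$ that is a bisimulation. (2) There exists a labeled Petri net for which $\approx\,\neq\,\sim$. (3) There exists a labeled Petri net for which $\simeq\,\neq\,\approx$. (4) For each labeled communication-free Petri net we have $\simeq\,=\,\approx\,=\,\sim$.
   Context: **Multisets.** For a finite set $P$, $\mathcal{M}(P)$ is the set of multisets over $P$, i.e. maps $m:P\to\mathbb{N}$ (with $0\in\mathbb N$), with componentwise sum and order $\le$, and truncated subtraction $(m-m')(p)=\max\{m(p)-m'(p),0\}$. The cardinality is $|m|=\sum_p m(p)$. **Labeled Petri nets.** A labeled Petri net is $N=(P,T,W,l)$ with finite disjoint sets $P$ (places) and $T$ (transitions), $W:(P\times T)\cup(T\times P)\to\mathbb{N}$, and $l:T\to\mathrm{Act}$ a labeling by actions from a set $\mathrm{Act}$. Markings, also called resources, are elements of $\mathcal{M}(P)$. For $t\in T$, the multisets ${}^\bullet t,t^\bullet\in\mathcal{M}(P)$ are given by ${}^\bullet t(p)=W(p,t)$ and $t^\bullet(p)=W(t,p)$. If ${}^\bullet t\le M$ then $t$ may fire in $M$, written $M\xrightarrow{t}M'$, where $M'=(M-{}^\bullet t)+t^\bullet$. The net is communication-free if $|{}^\bullet t|\le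 1$ for all $t\in T$. **Bisimilarity.** A relation $R\subseteq\mathcal{M}(P)\times\mathcal{M}(P)$ has the transfer property if for each $(M_1,M_2)\in R$ and each firing $M_1\xrightarrow{t}M_1'$ there is a firing $M_2\xrightarrow{u}M_2'$ with $l(u)=l(t)$ and $(M_1',M_2')\in R$. $R$ is a bisimulation if both $R$ and $R^{-1}$ have the transfer property. Bisimilarity $\sim$ is the union of all bisimulations. **Congruence.** An equivalence relation $\rho$ on $\mathcal{M}(P)$ is a congruence if $r_1\mathrel{\rho}r_2$ implies $(r_1+s)\mathrel{\rho}(r_2+s)$ for all $s\in\mathcal{M}(P)$. **Resource similarity.** $r\approx s$ iff $(r+w)\sim(s+w)$ for all $w\in\mathcal{M}(P)$. **Resource bisimilarity.** A relation $R\subseteq\mathcal{M}(P)\times\mathcal{M}(P)$ has the resource transfer property if for each $(r,s)\in R$ and each $t\in T$ with firing $(r+({}^\bullet t-r))\xrightarrow{t}r'$ there is a firing $(s+({}^\bullet t-r))\xrightarrow{u}s'$ with $u\in T$, $l(u)=l(t)$ and $(r',s')\in R$. $R$ is a resource bisimulation if both $R$ and $R^{-1}$ have the resource transfer property. Resource bisimilarity $\simeq$ is the union of all resource bisimulations. *)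

theory Defs
  imports "HOL-Library.Multiset"
begin

(* P and T are sets of nodes of one type, so that their disjointness is a condition and
   W is a single function. W and the labeling are total functions in HOL; values outside
   (P x T) Un (T x P) and outside T, respectively, are never used below. *)

record ('v, 'a) petri_net =
  places :: "'v set"
  transitions :: "'v set"
  weight :: "'v \<times> 'v \<Rightarrow> nat"
  label :: "'v \<Rightarrow> 'a"

definition labeled_petri_net :: "('v, 'a) petri_net \<Rightarrow> bool" where
  "labeled_petri_net N \<longleftrightarrow>
     finite (places N) \<and> finite (transitions N) \<and> places N \<inter> transitions N = {}"

definition markings :: "('v, 'a) petri_net \<Rightarrow> 'v multiset set" where
  "markings N = {M. set_mset M \<subseteq> places N}"

definition preset :: "('v, 'a) petri_net \<Rightarrow> 'v \<Rightarrow> 'v multiset" where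
  "preset N t = (\<Sum>p\<in>places N. replicate_mset (weight N (p, t)) p)"

definition postset :: "('v, 'a) petri_net \<Rightarrow> 'v \<Rightarrow> 'v multiset" where
  "postset N t = (\<Sum>p\<in>places N. replicate_mset (weight N (t, p)) p)"

lemma count_preset:
  "finite (places N) \<Longrightarrow> count (preset N t) p = (if p \<in> places N then weight N (p, t) else 0)"
  by (simp add: preset_def count_sum)

lemma count_postset:
  "finite (places N) \<Longrightarrow> count (postset N t) p = (if p \<in> places N then weight N (t, p) else 0)"
  by (simp add: postset_def count_sum)

definition fires ::
  "('v, 'a) petri_net \<Rightarrow> 'v multiset \<Rightarrow> 'v \<Rightarrow> 'v multiset \<Rightarrow> bool" where
  "fires N M t M' \<longleftrightarrow>
     t \<in> transitions N \<and> preset N t \<subseteq># M \<and> M' = (M - preset N t) + postset N t"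

definition communication_free :: "('v, 'a) petri_net \<Rightarrow> bool" where
  "communication_free N \<longleftrightarrow> (\<forall>t\<in>transitions N. size (preset N t) \<le> 1)"

definition transfer_property :: "('v, 'a) petri_net \<Rightarrow> 'v multiset rel \<Rightarrow> bool" where
  "transfer_property N R \<longleftrightarrow>
     (\<forall>(M1, M2)\<in>R. \<forall>t M1'. fires N M1 t M1' \<longrightarrow>
        (\<exists>u M2'. fires N M2 u M2' \<and> label N u = label N t \<and> (M1', M2') \<in> R))"

definition bisimulation :: "('v, 'a) petri_net \<Rightarrow> 'v multiset rel \<Rightarrow> bool" where
  "bisimulation N R \<longleftrightarrow>
     R \<subseteq> markings N \<times> markings N \<and> transfer_property N R \<and> transfer_property N (R\<inverse>)"

definition bisimilarity :: "('v, 'a) petri_net \<Rightarrow> 'v multiset rel" where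
  "bisimilarity N = \<Union>{R. bisimulation N R}"

(* equiv A r includes r <= A x A *)
definition congruence :: "('v, 'a) petri_net \<Rightarrow> 'v multiset rel \<Rightarrow> bool" where
  "congruence N \<rho> \<longleftrightarrow>
     equiv (markings N) \<rho> \<and>
     (\<forall>r1 r2. (r1, r2) \<in> \<rho> \<longrightarrow> (\<forall>s\<in>markings N. (r1 + s, r2 + s) \<in> \<rho>))"

definition resource_similarity :: "('v, 'a) petri_net \<Rightarrow> 'v multiset rel" where
  "resource_similarity N =
     {(r, s). r \<in> markings N \<and> s \<in> markings N \<and>
        (\<forall>w\<in>markings N. (r + w, s + w) \<in> bisimilarity N)}"

definition resource_transfer_property :: "('v, 'a) petri_net \<Rightarrow> 'v multiset rel \<Rightarrow> bool" where
  "resource_transfer_property N R \<longleftrightarrow>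
     (\<forall>(r, s)\<in>R. \<forall>t\<in>transitions N. \<forall>r'. fires N (r + (preset N t - r)) t r' \<longrightarrow>
        (\<exists>u\<in>transitions N. \<exists>s'. fires N (s + (preset N t - r)) u s' \<and>
           label N u = label N t \<and> (r', s') \<in> R))"

definition resource_bisimulation :: "('v, 'a) petri_net \<Rightarrow> 'v multiset rel \<Rightarrow> bool" where
  "resource_bisimulation N R \<longleftrightarrow>
     R \<subseteq> markings N \<times> markings N \<and>
     resource_transfer_property N R \<and> resource_transfer_property N (R\<inverse>)"

definition resource_bisimilarity :: "('v, 'a) petri_net \<Rightarrow> 'v multiset rel" where
  "resource_bisimilarity N = \<Union>{R. resource_bisimulation N R}"

definition is_largest :: "('b set \<Rightarrow> bool) \<Rightarrow> 'b set \<Rightarrow> bool" where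
  "is_largest Q X \<longleftrightarrow> Q X \<and> (\<forall>Y. Q Y \<longrightarrow> Y \<subseteq> X)"

end

(* Call a relation additive if it is closed under adding a common marking to both sides.
   For additive relations the bisimulation and resource bisimulation conditions coincide, and the
   additive closure of a resource bisimulation is again one; hence resource bisimilarity is the
   largest additive bisimulation. In a communication-free net every firing in r + w takes place
   within r or within w, so the additive closure of bisimilarity is a bisimulation and all three
   relations collapse. *)

theory Submission
  imports Defs
begin

section \<open>Additive relations and their basic rules\<close>

definition additive :: "('v, 'a) petri_net \<Rightarrow> 'v multiset rel \<Rightarrow> bool" where
  "additive N R \<longleftrightarrow> (\<forall>(r, s)\<in>R. \<forall>w\<in>markings N. (r + w, s + w) \<in> R)"

definition additive_closure :: "('v, 'a) petri_net \<Rightarrow> 'v multiset rel \<Rightarrow> 'v multiset rel" where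
  "additive_closure N R = {(r + w, s + w) | r s w. (r, s) \<in> R \<and> w \<in> markings N}"

lemma additiveD: "additive N R \<Longrightarrow> (r, s) \<in> R \<Longrightarrow> w \<in> markings N \<Longrightarrow> (r + w, s + w) \<in> R"
  by (auto simp: additive_def)

lemma transfer_propertyD:
  assumes "transfer_property N R" "(M1, M2) \<in> R" "fires N M1 t M1'"
  obtains u M2' where "fires N M2 u M2'" "label N u = label N t" "(M1', M2') \<in> R"
  using assms unfolding transfer_property_def by blast

lemma transfer_propertyI:
  assumes "\<And>M1 M2 t M1'. (M1, M2) \<in> R \<Longrightarrow> fires N M1 t M1' \<Longrightarrow>
     \<exists>u M2'. fires N M2 u M2' \<and> label N u = label N t \<and> (M1', M2') \<in> R"
  shows "transfer_property N R"
  using assms unfolding transfer_property_def by blast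

section \<open>Markings and firings in a context\<close>

lemma zero_marking: "{#} \<in> markings N"
  by (simp add: markings_def)

lemma add_markings: "r \<in> markings N \<Longrightarrow> w \<in> markings N \<Longrightarrow> r + w \<in> markings N"
  by (simp add: markings_def)

lemma diff_markings: "r \<in> markings N \<Longrightarrow> r - w \<in> markings N"
  by (auto simp: markings_def dest: in_diffD)

lemma preset_markings: "finite (places N) \<Longrightarrow> preset N t \<in> markings N"
  unfolding markings_def using count_preset[of N t]
  by (auto simp flip: count_greater_zero_iff split: if_splits)

lemma postset_markings: "finite (places N) \<Longrightarrow> postset N t \<in> markings N"
  unfolding markings_def using count_postset[of N t]
  by (auto simp flip: count_greater_zero_iff split: if_splits)

lemma fires_markings:
  "finite (places N) \<Longrightarrow> M \<in> markings N \<Longrightarrow> fires N M t M' \<Longrightarrow> M' \<in> markings N"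
  by (simp add: fires_def add_markings diff_markings postset_markings)

lemma fires_add: "fires N M t M' \<Longrightarrow> fires N (M + w) t (M' + w)"
  unfolding fires_def by (auto simp: subset_mset.add_increasing2 multiset_diff_union_assoc ac_simps)

text \<open>If \<open>M\<close> alone already supplies the preset, the tokens of \<open>w\<close>
  are spectators and survive the firing unchanged.\<close>

lemma fires_add_cases:
  assumes "fires N (M + w) t M'" "preset N t \<subseteq># M"
  obtains M'' where "fires N M t M''" "M' = M'' + w"
  using assms unfolding fires_def
  by (metis subset_mset.add_diff_assoc2 union_assoc union_commute)

section \<open>Resource bisimulations versus additive bisimulations\<close>

text \<open>Lets the backward half of a bisimulation proof reuse the forward half, applied to the
  converse of \<open>R\<close>.\<close>

lemma additive_closure_converse: "additive_closure N (R\<inverse>) = (additive_closure N R)\<inverse>"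
  by (auto simp: additive_closure_def)

text \<open>Two successive contexts merge into one by associativity, so adding a context once
  already gives a closed relation.\<close>

lemma additive_additive_closure: "additive N (additive_closure N R)"
  unfolding additive_def additive_closure_def
  by clarsimp (metis add_markings union_assoc)

lemma additive_closure_superset: "R \<subseteq> additive_closure N R"
  unfolding additive_closure_def using zero_marking by force

lemma additive_closure_markings:
  "R \<subseteq> markings N \<times> markings N \<Longrightarrow> additive_closure N R \<subseteq> markings N \<times> markings N"
  by (auto simp: additive_closure_def intro: add_markings)

lemma additive_converse: "additive N R \<Longrightarrow> additive N (R\<inverse>)"
  by (auto simp: additive_def)

text \<open>A transition enabled in \<open>r + w\<close> needs from \<open>w\<close> only the tokens
  missing in \<open>r\<close>. The resource transfer property answers the firing with exactly these
  tokens added; the rest of \<open>w\<close> is carried along on both sides.\<close>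

lemma additive_closure_transfer:
  assumes "resource_transfer_property N R"
  shows "transfer_property N (additive_closure N R)"
proof (rule transfer_propertyI)
  fix M1 M2 t M1'
  assume "(M1, M2) \<in> additive_closure N R" and f: "fires N M1 t M1'"
  then obtain r s w where M: "M1 = r + w" "M2 = s + w" "(r, s) \<in> R" and w: "w \<in> markings N"
    unfolding additive_closure_def by blast
  have t: "t \<in> transitions N" "preset N t \<subseteq># r + w"
    using f M by (auto simp: fires_def)
  \<comment> \<open>The least supplement that enables \<open>t\<close> at \<open>r\<close>.\<close>
  define d where "d = preset N t - r"
  have "d \<subseteq># w"
    using t(2) unfolding d_def by (simp add: subset_eq_diff_conv union_commute)
  then obtain w' where w': "w = d + w'"
    by (metis subset_mset.add_diff_inverse)
  have "preset N t \<subseteq># r + d"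
    unfolding d_def using subset_eq_diff_conv[of "preset N t" r "preset N t - r"]
    by (simp add: union_commute)
  moreover have "fires N ((r + d) + w') t M1'"
    using f M(1) w' by (simp add: union_assoc)
  ultimately obtain r' where r': "fires N (r + d) t r'" "M1' = r' + w'"
    using fires_add_cases by metis
  then obtain u s' where u: "fires N (s + d) u s'" "label N u = label N t" "(r', s') \<in> R"
    using assms M(3) t(1) unfolding resource_transfer_property_def d_def by blast
  \<comment> \<open>The reply may use \<open>d\<close> differently from \<open>t\<close>, but it
    never touches \<open>w'\<close>.\<close>
  have "fires N M2 u (s' + w')"
    using fires_add[OF u(1), of w'] M(2) w' by (simp add: union_assoc)
  moreover have "(M1', s' + w') \<in> additive_closure N R"
    using w u(3) unfolding additive_closure_def r'(2) w' by (auto simp: markings_def)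
  ultimately show "\<exists>u M2'. fires N M2 u M2' \<and> label N u = label N t \<and>
      (M1', M2') \<in> additive_closure N R"
    using u(2) by blast
qed

lemma bisimulation_additive_closure:
  assumes "resource_bisimulation N R"
  shows "bisimulation N (additive_closure N R)"
  using assms additive_closure_transfer[of N R] additive_closure_transfer[of N "R\<inverse>"]
    additive_closure_markings[of R N]
  by (auto simp: bisimulation_def resource_bisimulation_def additive_closure_converse)

text \<open>The missing tokens form a marking, so additivity allows adding them to both sides;
  ordinary transfer then applies to the enlarged pair.\<close>

lemma additive_transfer_imp_resource_transfer:
  assumes "finite (places N)" "additive N R" "transfer_property N R"
  shows "resource_transfer_property N R"
  unfolding resource_transfer_property_def
proof clarify
  fix r s t r'
  assume "(r, s) \<in> R" "fires N (r + (preset N t - r)) t r'"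
  moreover from this(1) have "(r + (preset N t - r), s + (preset N t - r)) \<in> R"
    by (intro additiveD[OF assms(2)] diff_markings preset_markings assms(1))
  ultimately obtain u s' where u: "fires N (s + (preset N t - r)) u s'"
      "label N u = label N t" "(r', s') \<in> R"
    using transfer_propertyD[OF assms(3)] by metis
  moreover have "u \<in> transitions N"
    using u(1) by (simp add: fires_def)
  ultimately show "\<exists>u\<in>transitions N. \<exists>s'. fires N (s + (preset N t - r)) u s' \<and>
      label N u = label N t \<and> (r', s') \<in> R"
    by blast
qed

lemma additive_bisimulation_imp_resource_bisimulation:
  "finite (places N) \<Longrightarrow> additive N R \<Longrightarrow> bisimulation N R \<Longrightarrow> resource_bisimulation N R"
  by (simp add: bisimulation_def resource_bisimulation_def additive_converse
      additive_transfer_imp_resource_transfer)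

text \<open>A resource bisimulation need not be additive itself, so the first inclusion goes through
  its additive closure. From here on, resource bisimilarity is handled as a union of ordinary
  bisimulations.\<close>

lemma resource_bisimilarity_eq:
  assumes "finite (places N)"
  shows "resource_bisimilarity N = \<Union>{R. additive N R \<and> bisimulation N R}"
proof (intro equalityI)
  show "resource_bisimilarity N \<subseteq> \<Union>{R. additive N R \<and> bisimulation N R}"
    unfolding resource_bisimilarity_def
  proof (rule Union_least)
    fix R assume "R \<in> {R. resource_bisimulation N R}"
    then have "bisimulation N (additive_closure N R)"
      by (simp add: bisimulation_additive_closure)
    then show "R \<subseteq> \<Union>{R. additive N R \<and> bisimulation N R}"
      using additive_closure_superset[of R N] additive_additive_closure[of N R] by blast
  qed
  show "\<Union>{R. additive N R \<and> bisimulation N R} \<subseteq> resource_bisimilarity N"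
    unfolding resource_bisimilarity_def
    using additive_bisimulation_imp_resource_bisimulation[OF assms] by blast
qed

section \<open>Bisimilarity as the largest bisimulation\<close>

lemma bisimulation_Id_on: "finite (places N) \<Longrightarrow> bisimulation N (Id_on (markings N))"
  by (auto simp: bisimulation_def transfer_property_def intro: fires_markings)

lemma bisimulation_converse: "bisimulation N R \<Longrightarrow> bisimulation N (R\<inverse>)"
  by (auto simp: bisimulation_def)

lemma transfer_property_relcomp:
  assumes "transfer_property N R" "transfer_property N S"
  shows "transfer_property N (R O S)"
proof (rule transfer_propertyI)
  fix M1 M3 t M1'
  assume "(M1, M3) \<in> R O S" and f: "fires N M1 t M1'"
  then obtain M2 where "(M1, M2) \<in> R" "(M2, M3) \<in> S"
    by blast
  with f obtain u M2' where "fires N M2 u M2'" "label N u = label N t" "(M1', M2') \<in> R"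
    using transfer_propertyD[OF assms(1)] by metis
  moreover from this(1) \<open>(M2, M3) \<in> S\<close> obtain v M3' where
    "fires N M3 v M3'" "label N v = label N u" "(M2', M3') \<in> S"
    using transfer_propertyD[OF assms(2)] by metis
  ultimately show "\<exists>v M3'. fires N M3 v M3' \<and> label N v = label N t \<and> (M1', M3') \<in> R O S"
    by (metis relcomp.relcompI)
qed

lemma bisimulation_relcomp:
  "bisimulation N R \<Longrightarrow> bisimulation N S \<Longrightarrow> bisimulation N (R O S)"
  by (auto simp: bisimulation_def converse_relcomp transfer_property_relcomp)

lemma additive_relcomp: "additive N R \<Longrightarrow> additive N S \<Longrightarrow> additive N (R O S)"
  unfolding additive_def by blast

lemma transfer_property_Union:
  assumes "\<And>R. R \<in> A \<Longrightarrow> transfer_property N R"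
  shows "transfer_property N (\<Union>A)"
proof (rule transfer_propertyI)
  fix M1 M2 t M1'
  assume "(M1, M2) \<in> \<Union>A" and f: "fires N M1 t M1'"
  then obtain R where R: "R \<in> A" "(M1, M2) \<in> R"
    by blast
  then obtain u M2' where "fires N M2 u M2'" "label N u = label N t" "(M1', M2') \<in> R"
    using transfer_propertyD[OF assms[OF R(1)] R(2) f] by metis
  then show "\<exists>u M2'. fires N M2 u M2' \<and> label N u = label N t \<and> (M1', M2') \<in> \<Union>A"
    using R(1) by blast
qed

lemma bisimulation_Union:
  assumes "\<And>R. R \<in> A \<Longrightarrow> bisimulation N R"
  shows "bisimulation N (\<Union>A)"
proof -
  \<comment> \<open>The converse of a union is the union of the converses, so both directions are
    instances of the same lemma.\<close>
  have "transfer_property N (\<Union>A)" "transfer_property N (\<Union>(converse ` A))"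
    by (intro transfer_property_Union; use assms in \<open>auto simp: bisimulation_def\<close>)+
  moreover have "(\<Union>A)\<inverse> = \<Union>(converse ` A)" "\<Union>A \<subseteq> markings N \<times> markings N"
    using assms unfolding bisimulation_def by blast+
  ultimately show ?thesis
    by (simp add: bisimulation_def)
qed

lemma bisimulation_bisimilarity: "bisimulation N (bisimilarity N)"
  unfolding bisimilarity_def by (rule bisimulation_Union) simp

lemma bisimulation_subset_bisimilarity: "bisimulation N R \<Longrightarrow> R \<subseteq> bisimilarity N"
  unfolding bisimilarity_def by blast

text \<open>As the largest bisimulation, bisimilarity absorbs the identity, its own converse and its
  composition with itself.\<close>

lemma equiv_bisimilarity:
  assumes "finite (places N)"
  shows "equiv (markings N) (bisimilarity N)"
proof (rule equivI)
  show "bisimilarity N \<subseteq> markings N \<times> markings N"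
    using bisimulation_bisimilarity by (auto simp: bisimulation_def)
  show "refl_on (markings N) (bisimilarity N)"
    using bisimulation_subset_bisimilarity[OF bisimulation_Id_on[OF assms]]
    by (auto simp: refl_on_def)
  show "sym (bisimilarity N)"
    using bisimulation_subset_bisimilarity[OF bisimulation_converse[OF bisimulation_bisimilarity]]
    by (auto simp: sym_def)
  show "trans (bisimilarity N)"
    using bisimulation_subset_bisimilarity
      [OF bisimulation_relcomp[OF bisimulation_bisimilarity bisimulation_bisimilarity]]
    by (auto simp: trans_def)
qed

section \<open>Congruences below bisimilarity\<close>

lemma bisimulation_resource_bisimilarity:
  "finite (places N) \<Longrightarrow> bisimulation N (resource_bisimilarity N)"
  unfolding resource_bisimilarity_eq by (rule bisimulation_Union) simp

lemma additive_resource_bisimilarity: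
  "finite (places N) \<Longrightarrow> additive N (resource_bisimilarity N)"
  unfolding resource_bisimilarity_eq additive_def by blast

lemma additive_bisimulation_subset_resource_bisimilarity:
  "finite (places N) \<Longrightarrow> additive N R \<Longrightarrow> bisimulation N R \<Longrightarrow> R \<subseteq> resource_bisimilarity N"
  unfolding resource_bisimilarity_eq by blast

lemma congruence_iff: "congruence N \<rho> \<longleftrightarrow> equiv (markings N) \<rho> \<and> additive N \<rho>"
  by (auto simp: congruence_def additive_def)

text \<open>The argument for bisimilarity is repeated within the additive bisimulations, which also
  include the identity and are closed under converse and composition.\<close>

lemma congruence_resource_bisimilarity:
  assumes "finite (places N)"
  shows "congruence N (resource_bisimilarity N)"
  unfolding congruence_iff
proof (intro conjI equivI)
  note B = bisimulation_resource_bisimilarity[OF assms]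
  note A = additive_resource_bisimilarity[OF assms]
  note sub = additive_bisimulation_subset_resource_bisimilarity[OF assms]
  show "additive N (resource_bisimilarity N)" by (rule A)
  show "resource_bisimilarity N \<subseteq> markings N \<times> markings N"
    using B by (auto simp: bisimulation_def)
  have "additive N (Id_on (markings N))"
    by (auto simp: additive_def intro: add_markings)
  from sub[OF this bisimulation_Id_on[OF assms]]
  show "refl_on (markings N) (resource_bisimilarity N)"
    by (auto simp: refl_on_def)
  show "sym (resource_bisimilarity N)"
    using sub[OF additive_converse[OF A] bisimulation_converse[OF B]] by (auto simp: sym_def)
  show "trans (resource_bisimilarity N)"
    using sub[OF additive_relcomp[OF A A] bisimulation_relcomp[OF B B]] by (auto simp: trans_def)
qed

lemma resource_similarity_subset: "resource_similarity N \<subseteq> bisimilarity N"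
  unfolding resource_similarity_def using zero_marking by force

text \<open>A pair in a congruence stays in it, and hence stays bisimilar, in every context.\<close>

lemma congruence_subset_resource_similarity:
  assumes "congruence N \<rho>" "\<rho> \<subseteq> bisimilarity N"
  shows "\<rho> \<subseteq> resource_similarity N"
  using assms equiv_type[of "markings N" \<rho>]
  unfolding resource_similarity_def congruence_def by blast

lemma congruence_resource_similarity:
  assumes "finite (places N)"
  shows "congruence N (resource_similarity N)"
  unfolding congruence_iff
proof (intro conjI equivI)
  have E: "refl_on (markings N) (bisimilarity N)" "sym (bisimilarity N)" "trans (bisimilarity N)"
    using equiv_bisimilarity[OF assms] by (auto elim: equivE)
  show "resource_similarity N \<subseteq> markings N \<times> markings N"
    by (auto simp: resource_similarity_def)
  show "refl_on (markings N) (resource_similarity N)"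
    using E(1) by (auto simp: resource_similarity_def refl_on_def add_markings)
  show "sym (resource_similarity N)"
    using E(2) by (auto simp: resource_similarity_def sym_def)
  show "trans (resource_similarity N)"
    using E(3) by (auto simp: resource_similarity_def intro!: transI dest: transD)
  \<comment> \<open>A context of a context is a context: the added marking is absorbed into the
    quantified one.\<close>
  show "additive N (resource_similarity N)"
    by (auto simp: additive_def resource_similarity_def add_markings union_assoc)
qed

lemma resource_bisimilarity_subset:
  "finite (places N) \<Longrightarrow> resource_bisimilarity N \<subseteq> resource_similarity N"
  by (intro congruence_subset_resource_similarity congruence_resource_bisimilarity
      bisimulation_subset_bisimilarity bisimulation_resource_bisimilarity)

section \<open>Communication-free nets\<close>

text \<open>A firing inside \<open>r\<close> is answered through \<open>R\<close> with the context
  kept. A firing inside \<open>w\<close> is answered by the same transition, which keeps the pair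
  \<open>(r, s)\<close> and only changes the context.\<close>

lemma communication_free_additive_closure_transfer:
  assumes fin: "finite (places N)" and cf: "communication_free N" and R: "transfer_property N R"
  shows "transfer_property N (additive_closure N R)"
proof (rule transfer_propertyI)
  fix M1 M2 t M1'
  assume "(M1, M2) \<in> additive_closure N R" and f: "fires N M1 t M1'"
  then obtain r s w where M: "M1 = r + w" "M2 = s + w" "(r, s) \<in> R" and w: "w \<in> markings N"
    unfolding additive_closure_def by blast
  have "size (preset N t) \<le> 1" "preset N t \<subseteq># r + w"
    using f cf M(1) by (auto simp: fires_def communication_free_def)
  \<comment> \<open>A single consumed token cannot be split between \<open>r\<close> and
    \<open>w\<close>.\<close>
  then have "preset N t = {#} \<or> (\<exists>p. preset N t = {#p#} \<and> p \<in># r + w)"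
    by (auto simp: le_Suc_eq dest!: size_1_singleton_mset[unfolded One_nat_def])
  then consider "preset N t \<subseteq># r" | "preset N t \<subseteq># w"
    by auto
  then show "\<exists>u M2'. fires N M2 u M2' \<and> label N u = label N t \<and>
      (M1', M2') \<in> additive_closure N R"
  proof cases
    case 1
    then obtain r' where r': "fires N r t r'" "M1' = r' + w"
      using fires_add_cases f M(1) by metis
    then obtain u s' where "fires N s u s'" "label N u = label N t" "(r', s') \<in> R"
      using transfer_propertyD[OF R M(3)] by metis
    then show ?thesis
      using fires_add[of N s u s' w] w r'(2) M(2) unfolding additive_closure_def by blast
  next
    case 2
    then obtain w' where w': "fires N w t w'" "M1' = r + w'"
      using fires_add_cases[of N w r t M1'] f M(1) by (metis union_commute)
    then have "fires N M2 t (s + w')"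
      using fires_add[of N w t w' s] M(2) by (simp add: union_commute)
    moreover have "w' \<in> markings N"
      using fires_markings[OF fin w w'(1)] .
    ultimately show ?thesis
      using w'(2) M(3) unfolding additive_closure_def by blast
  qed
qed

lemma communication_free_bisimilarity:
  assumes "finite (places N)" "communication_free N"
  shows "bisimilarity N \<subseteq> resource_bisimilarity N"
proof -
  have "bisimulation N (additive_closure N (bisimilarity N))"
    using bisimulation_bisimilarity[of N] additive_closure_markings[of "bisimilarity N" N]
      communication_free_additive_closure_transfer[OF assms]
    unfolding bisimulation_def by (simp flip: additive_closure_converse)
  then have "additive_closure N (bisimilarity N) \<subseteq> resource_bisimilarity N"
    using additive_bisimulation_subset_resource_bisimilarity[OF assms(1)]
      additive_additive_closure by blast
  then show ?thesis
    using additive_closure_superset by blast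
qed

section \<open>Nets for which the inclusions are strict\<close>

text \<open>The markings with zero and one token are both dead, but adding one more token separates
  them.\<close>

definition pair_net :: "(nat, nat) petri_net" where
  "pair_net = \<lparr>places = {0}, transitions = {1},
     weight = (\<lambda>(x, y). if x = 0 \<and> y = 1 then 2 else 0), label = (\<lambda>_. 0)\<rparr>"

lemma fires_pair_net:
  "fires pair_net M t M' \<longleftrightarrow> t = 1 \<and> {#0, 0#} \<subseteq># M \<and> M' = M - {#0, 0#}"
proof -
  have "preset pair_net 1 = {#0, 0#}" "postset pair_net 1 = {#}"
    by (simp_all add: preset_def postset_def pair_net_def numeral_2_eq_2)
  moreover have "transitions pair_net = {1}"
    by (simp add: pair_net_def)
  ultimately show ?thesis
    unfolding fires_def by (metis add.right_neutral singleton_iff)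
qed

lemma pair_net_strict: "resource_similarity pair_net \<noteq> bisimilarity pair_net"
proof
  assume eq: "resource_similarity pair_net = bisimilarity pair_net"
  have m: "{#0#} \<in> markings pair_net" "{#} \<in> markings pair_net"
    by (simp_all add: markings_def pair_net_def)
  \<comment> \<open>The transfer conditions hold vacuously: neither marking has the two tokens
    required for firing.\<close>
  have "bisimulation pair_net {({#0#}, {#})}"
    using m unfolding bisimulation_def transfer_property_def
    by (auto simp: fires_pair_net dest: size_mset_mono)
  then have "({#0#}, {#}) \<in> resource_similarity pair_net"
    using bisimulation_subset_bisimilarity unfolding eq by blast
  \<comment> \<open>The context \<open>{#0#}\<close> completes the required pair of tokens on the
    left only.\<close>
  then have "({#0#} + {#0#}, {#} + {#0#}) \<in> bisimilarity pair_net"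
    using m unfolding resource_similarity_def by blast
  moreover have "fires pair_net ({#0#} + {#0#}) 1 {#}"
    by (simp add: fires_pair_net)
  ultimately obtain u M where "fires pair_net ({#} + {#0#}) u M"
    using bisimulation_bisimilarity unfolding bisimulation_def by (metis transfer_propertyD)
  then show False
    by (auto simp: fires_pair_net dest: size_mset_mono)
qed

text \<open>Places 0, 1, 2; action 0 for transitions 3, 4, 5 and action 1 for transition 6:
  3 has no effect, 4 creates 1 and 2, 5 moves a token from 0 to 1, and 6 tests for 1 and 2.
  Once enabled, 6 stays enabled, so bisimilarity only sees whether 6 is enabled, and the empty
  marking is resource similar to a token on 0. But no fixed reply to 5 suits all contexts:
  replying with 3 fails in the presence of a token on 2, and replying with 4 fails without it.\<close>

definition choice_net :: "(nat, nat) petri_net" where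
  "choice_net = \<lparr>places = {0, 1, 2}, transitions = {3, 4, 5, 6},
     weight = (\<lambda>e. if e \<in> {(4, 1), (4, 2), (0, 5), (5, 1), (1, 6), (2, 6), (6, 1), (6, 2)}
                   then 1 else 0),
     label = (\<lambda>t. if t = 6 then 1 else 0)\<rparr>"

lemma choice_net_simps:
  "preset choice_net 3 = {#}" "postset choice_net 3 = {#}"
  "preset choice_net 4 = {#}" "postset choice_net 4 = {#1, 2#}"
  "preset choice_net 5 = {#0#}" "postset choice_net 5 = {#1#}"
  "preset choice_net 6 = {#1, 2#}" "postset choice_net 6 = {#1, 2#}"
  "label choice_net t = (if t = 6 then 1 else 0)"
  by (simp_all add: preset_def postset_def choice_net_def)

lemma fires_choice_net:
  "fires choice_net M t M' \<longleftrightarrow>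
     t = 3 \<and> M' = M \<or>
     t = 4 \<and> M' = M + {#1, 2#} \<or>
     t = 5 \<and> 0 \<in># M \<and> M' = M - {#0#} + {#1#} \<or>
     t = 6 \<and> {#1, 2#} \<subseteq># M \<and> M' = M"
proof -
  have "t \<in> transitions choice_net \<longleftrightarrow> t = 3 \<or> t = 4 \<or> t = 5 \<or> t = 6"
    by (simp add: choice_net_def)
  \<comment> \<open>Transition 6 returns what it consumes, so it acts as a pure test.\<close>
  moreover have "{#1, 2#} \<subseteq># M \<and> M' = M - {#1, 2#} + {#1, 2#} \<longleftrightarrow> {#1, 2#} \<subseteq># M \<and> M' = M"
    by (metis subset_mset.diff_add)
  ultimately show ?thesis
    unfolding fires_def
    by (cases "t = 3"; cases "t = 4"; cases "t = 5"; cases "t = 6") (simp_all add: choice_net_simps)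
qed

text \<open>Reduces enabledness of transition 6 to separate tests of places 1 and 2.\<close>

lemma pair_subset_iff: "a \<noteq> b \<Longrightarrow> {#a, b#} \<subseteq># M \<longleftrightarrow> a \<in># M \<and> b \<in># M"
  by (auto simp: insert_subset_eq_iff in_diff_count)

text \<open>Agreement on whether transition 6 is enabled. This is in fact bisimilarity on
  \<open>choice_net\<close>: one inclusion is \<open>bisimulation_choice_relation\<close>, the other
  follows from \<open>choice_net_bisimilar_pair\<close> and symmetry.\<close>

definition choice_relation :: "nat multiset rel" where
  "choice_relation = {(M, M'). M \<in> markings choice_net \<and> M' \<in> markings choice_net \<and>
     ({#1, 2#} \<subseteq># M \<longleftrightarrow> {#1, 2#} \<subseteq># M')}"

lemma finite_places_choice_net: "finite (places choice_net)"
  by (simp add: choice_net_def)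

text \<open>Transition 6 is answered by itself. Any other firing is answered by 4 if it leads to a
  marking enabling 6, and by 3 if it does not.\<close>

lemma bisimulation_choice_relation: "bisimulation choice_net choice_relation"
proof -
  have "transfer_property choice_net choice_relation"
  proof (rule transfer_propertyI)
    fix M1 M2 t M1'
    assume R: "(M1, M2) \<in> choice_relation" and f: "fires choice_net M1 t M1'"
    have M1': "M1' \<in> markings choice_net"
      using R f fires_markings[OF finite_places_choice_net] by (auto simp: choice_relation_def)
    \<comment> \<open>Only 5 and 6 consume tokens; 5 takes from place 0 alone and 6 restores its
      input.\<close>
    have mono: "{#1, 2#} \<subseteq># M1 \<Longrightarrow> {#1, 2#} \<subseteq># M1'"
      using f by (auto simp: fires_choice_net pair_subset_iff in_diff_count)
    have M2': "M2 + {#1, 2#} \<in> markings choice_net"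
      using R by (auto simp: choice_relation_def markings_def choice_net_def)
    consider "t = 6" | "t \<noteq> 6" "{#1, 2#} \<subseteq># M1'" | "t \<noteq> 6" "\<not> {#1, 2#} \<subseteq># M1'"
      by blast
    then show "\<exists>u M2'. fires choice_net M2 u M2' \<and> label choice_net u = label choice_net t \<and>
        (M1', M2') \<in> choice_relation"
    proof cases
      case 1
      then have "fires choice_net M2 6 M2" "(M1', M2) \<in> choice_relation"
        using R f by (auto simp: fires_choice_net choice_relation_def)
      then show ?thesis using 1 by blast
    next
      case 2
      then have "fires choice_net M2 4 (M2 + {#1, 2#})" "(M1', M2 + {#1, 2#}) \<in> choice_relation"
        using M1' M2' by (simp_all add: fires_choice_net choice_relation_def pair_subset_iff)
      moreover have "label choice_net 4 = label choice_net t"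
        using 2 by (simp add: choice_net_simps)
      ultimately show ?thesis by blast
    next
      case 3
      then have "fires choice_net M2 3 M2" "(M1', M2) \<in> choice_relation"
        using R M1' mono by (auto simp: fires_choice_net choice_relation_def)
      moreover have "label choice_net 3 = label choice_net t"
        using 3 by (simp add: choice_net_simps)
      ultimately show ?thesis by blast
    qed
  qed
  \<comment> \<open>By symmetry one transfer property is enough.\<close>
  moreover have "choice_relation\<inverse> = choice_relation"
    by (auto simp: choice_relation_def)
  ultimately show ?thesis
    by (auto simp: bisimulation_def choice_relation_def)
qed

text \<open>Transition 6 is the only one with action 1, so its firing can be answered only by
  itself.\<close>

lemma choice_net_bisimilar_pair:
  assumes "(M, M') \<in> bisimilarity choice_net" "{#1, 2#} \<subseteq># M"
  shows "{#1, 2#} \<subseteq># M'"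
proof -
  have "fires choice_net M 6 M"
    using assms(2) by (simp add: fires_choice_net)
  then obtain u M'' where "fires choice_net M' u M''" "label choice_net u = label choice_net 6"
    using assms(1) bisimulation_bisimilarity
    unfolding bisimulation_def by (metis transfer_propertyD)
  moreover from this(2) have "u = 6"
    by (simp add: choice_net_simps split: if_splits)
  ultimately show ?thesis
    by (simp add: fires_choice_net)
qed

lemma choice_net_strict: "resource_bisimilarity choice_net \<noteq> resource_similarity choice_net"
proof
  assume eq: "resource_bisimilarity choice_net = resource_similarity choice_net"
  have m: "{#0#} \<in> markings choice_net" "{#2#} \<in> markings choice_net"
    by (simp_all add: markings_def choice_net_def)
  \<comment> \<open>A token on place 0 has no influence on whether 6 is enabled.\<close>
  have "({#0#} + w, {#} + w) \<in> choice_relation" if "w \<in> markings choice_net" for w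
    using that by (simp add: choice_relation_def pair_subset_iff markings_def choice_net_def)
  then have "({#0#} + w, {#} + w) \<in> bisimilarity choice_net" if "w \<in> markings choice_net" for w
    using bisimulation_subset_bisimilarity[OF bisimulation_choice_relation] that by blast
  then have "({#0#}, {#}) \<in> resource_bisimilarity choice_net"
    unfolding eq resource_similarity_def using m(1) zero_marking by auto
  moreover have "fires choice_net {#0#} 5 {#1#}"
    by (simp add: fires_choice_net)
  \<comment> \<open>Resource bisimilarity is itself a bisimulation, so the reply is chosen without
    any context, yet its result must be similar to \<open>{#1#}\<close> in all contexts.\<close>
  ultimately obtain u M where u: "fires choice_net {#} u M"
      "label choice_net u = label choice_net 5" "({#1#}, M) \<in> resource_bisimilarity choice_net"
    using bisimulation_resource_bisimilarity[OF finite_places_choice_net]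
    unfolding bisimulation_def by (metis transfer_propertyD)
  then have rs: "({#1#}, M) \<in> resource_similarity choice_net"
    by (simp add: eq)
  \<comment> \<open>From the empty marking only 3 and 4 can fire.\<close>
  from u(1,2) consider "M = {#}" | "M = {#1, 2#}"
    by (auto simp: fires_choice_net)
  then show False
  proof cases
    case 1
    \<comment> \<open>In the context \<open>{#2#}\<close> only the left side enables 6.\<close>
    then have "({#1#} + {#2#}, {#2#}) \<in> bisimilarity choice_net"
      using rs m(2) unfolding resource_similarity_def by fastforce
    then show False
      using choice_net_bisimilar_pair by (fastforce simp: pair_subset_iff)
  next
    case 2
    \<comment> \<open>The empty context suffices here; the pair is reversed because
      \<open>choice_net_bisimilar_pair\<close> carries enabledness from left to right.\<close>
    then have "({#1, 2#}, {#1#}) \<in> bisimilarity choice_net"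
      using rs resource_similarity_subset equiv_bisimilarity[OF finite_places_choice_net]
      by (blast elim: equivE dest: symD)
    then show False
      using choice_net_bisimilar_pair by (fastforce simp: pair_subset_iff)
  qed
qed

theorem theorem3p8:
  shows "(\<forall>N :: ('v, 'a) petri_net. labeled_petri_net N \<longrightarrow>
            resource_bisimilarity N \<subseteq> resource_similarity N \<and>
            resource_similarity N \<subseteq> bisimilarity N \<and>
            is_largest (\<lambda>\<rho>. congruence N \<rho> \<and> \<rho> \<subseteq> bisimilarity N) (resource_similarity N) \<and>
            is_largest (\<lambda>\<rho>. congruence N \<rho> \<and> \<rho> \<subseteq> bisimilarity N \<and> bisimulation N \<rho>)
              (resource_bisimilarity N)) \<and>
         (\<exists>N :: (nat, nat) petri_net. labeled_petri_net N \<and>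
            resource_similarity N \<noteq> bisimilarity N) \<and>
         (\<exists>N :: (nat, nat) petri_net. labeled_petri_net N \<and>
            resource_bisimilarity N \<noteq> resource_similarity N) \<and>
         (\<forall>N :: ('v, 'a) petri_net. labeled_petri_net N \<and> communication_free N \<longrightarrow>
            resource_bisimilarity N = resource_similarity N \<and>
            resource_similarity N = bisimilarity N)"
proof (intro conjI allI impI)
  fix N :: "('v, 'a) petri_net"
  assume "labeled_petri_net N"
  then have fin: "finite (places N)"
    by (simp add: labeled_petri_net_def)
  show "resource_bisimilarity N \<subseteq> resource_similarity N"
    using resource_bisimilarity_subset[OF fin] .
  show "resource_similarity N \<subseteq> bisimilarity N"
    by (rule resource_similarity_subset)
  show "is_largest (\<lambda>\<rho>. congruence N \<rho> \<and> \<rho> \<subseteq> bisimilarity N) (resource_similarity N)"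
    unfolding is_largest_def
    using congruence_resource_similarity[OF fin] resource_similarity_subset
      congruence_subset_resource_similarity by blast
  show "is_largest (\<lambda>\<rho>. congruence N \<rho> \<and> \<rho> \<subseteq> bisimilarity N \<and> bisimulation N \<rho>)
      (resource_bisimilarity N)"
    unfolding is_largest_def
    \<comment> \<open>By \<open>congruence_iff\<close>, a congruence that is a bisimulation is an
      additive bisimulation, hence lies in resource bisimilarity.\<close>
    using congruence_resource_bisimilarity[OF fin] bisimulation_resource_bisimilarity[OF fin]
      bisimulation_subset_bisimilarity additive_bisimulation_subset_resource_bisimilarity[OF fin]
      congruence_iff by metis
next
  have "labeled_petri_net pair_net"
    by (simp add: labeled_petri_net_def pair_net_def)
  then show "\<exists>N :: (nat, nat) petri_net. labeled_petri_net N \<and>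
      resource_similarity N \<noteq> bisimilarity N"
    using pair_net_strict by blast
  have "labeled_petri_net choice_net"
    by (simp add: labeled_petri_net_def choice_net_def)
  then show "\<exists>N :: (nat, nat) petri_net. labeled_petri_net N \<and>
      resource_bisimilarity N \<noteq> resource_similarity N"
    using choice_net_strict by blast
next
  fix N :: "('v, 'a) petri_net"
  assume "labeled_petri_net N \<and> communication_free N"
  then have fin: "finite (places N)" and cf: "communication_free N"
    by (auto simp: labeled_petri_net_def)
  \<comment> \<open>These three inclusions form a cycle through the three relations.\<close>
  note inclusions = resource_bisimilarity_subset[OF fin] resource_similarity_subset[of N]
    communication_free_bisimilarity[OF fin cf]
  show "resource_bisimilarity N = resource_similarity N"
    using inclusions by blast
  show "resource_similarity N = bisimilarity N"
    using inclusions by blast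
qed

end
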